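(* For every graph $F$ there exist integers $N_F$, $a_F$, $C_F$, depending only on $F$, such that for every $n\geq N_F$, $$\mathrm{rk}\text{-}\mathrm{sat}(K_n,F)=a_F n+C_F.$$
   Context: $K_n$ denotes the complete graph on $n$ vertices. For a matroid $M$ on a ground set $E$ and $A\subseteq E$, $\mathrm{rk}_M(A)$ is the rank of $A$ in $M$. A matroid $M$ on the edge set $E(G)$ of a graph $G$ is called weakly $F$-saturated if every copy $\tilde F$ of $F$ in $G$ is a cycle of $M$, i.e. $\mathrm{rk}_M(E(\tilde F)\setminus\{e\})=\mathrm{rk}_M(E(\tilde F))$ for every $e\in E(\tilde F)$. The weak $F$-saturation rank $\mathrm{rk}\text{-}\mathrm{sat}(G,F)$ is the maximum rank of a weakly $F$-saturated matroid on $E(G)$.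
   Formalization: The graph F is assumed to have at least one edge; for edgeless F every matroid is vacuously weakly F-saturated, so rk-sat(K_n,F)=n(n-1)/2, which is not linear in n. *)

theory Defs
  imports Main
begin

definition simple_graph :: "'a set \<Rightarrow> 'a set set \<Rightarrow> bool" where
  "simple_graph V E \<longleftrightarrow> finite V \<and>
     (\<forall>e\<in>E. \<exists>u v. e = {u, v} \<and> u \<noteq> v \<and> u \<in> V \<and> v \<in> V)"

definition Kn_edges :: "nat \<Rightarrow> nat set set" where
  "Kn_edges n = {{u, v} | u v. u < n \<and> v < n \<and> u \<noteq> v}"

definition matroid :: "'e set \<Rightarrow> 'e set set \<Rightarrow> bool" where
  "matroid G I \<longleftrightarrow> finite G \<and> I \<subseteq> Pow G \<and> {} \<in> I \<and>
     (\<forall>X Y. X \<in> I \<and> Y \<subseteq> X \<longrightarrow> Y \<in> I) \<and>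
     (\<forall>X Y. X \<in> I \<and> Y \<in> I \<and> card X < card Y \<longrightarrow> (\<exists>e\<in>Y - X. insert e X \<in> I))"

definition mrank :: "'e set set \<Rightarrow> 'e set \<Rightarrow> nat" where
  "mrank I A = Max (card ` {X \<in> I. X \<subseteq> A})"

definition copies_in_Kn :: "nat \<Rightarrow> 'a set \<Rightarrow> 'a set set \<Rightarrow> nat set set set" where
  "copies_in_Kn n V E =
     {(\<lambda>e. \<phi> ` e) ` E | \<phi>. inj_on \<phi> V \<and> \<phi> ` V \<subseteq> {..<n}}"

definition is_cycle :: "'e set set \<Rightarrow> 'e set \<Rightarrow> bool" where
  "is_cycle I C \<longleftrightarrow> (\<forall>e\<in>C. mrank I (C - {e}) = mrank I C)"

definition weakly_sat :: "nat \<Rightarrow> 'a set \<Rightarrow> 'a set set \<Rightarrow> nat set set set \<Rightarrow> bool" where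
  "weakly_sat n V E I \<longleftrightarrow> matroid (Kn_edges n) I \<and>
     (\<forall>C\<in>copies_in_Kn n V E. is_cycle I C)"

definition rk_sat :: "nat \<Rightarrow> 'a set \<Rightarrow> 'a set set \<Rightarrow> nat" where
  "rk_sat n V E = Max {mrank I (Kn_edges n) | I. weakly_sat n V E I}"

end

theory Submission
  imports Defs
begin

text \<open>
  Let \<open>r\<^sub>n\<close> be the rank in question and \<open>s = |V(F)| - 2\<close>, and for a weakly \<open>F\<close>-saturated matroid let \<open>f(S)\<close> be the rank of the complete
  graph on \<open>S\<close>. If \<open>|X| \<ge> s\<close>, a copy of \<open>F\<close> through the edge \<open>vw\<close> with its other vertices in \<open>X\<close> shows
  that \<open>vw\<close> is spanned by the complete graphs on \<open>X + v\<close> and \<open>X + w\<close>, so submodularity of the rank makes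
  the increments \<open>f(X + v) - f(X)\<close> nonincreasing in \<open>X\<close>. In an optimal matroid on \<open>K\<^sub>n\<^sub>+\<^sub>1\<close> the last
  increments are all at least \<open>r\<^sub>n\<^sub>+\<^sub>1 - r\<^sub>n\<close>, hence so are all earlier ones. Let \<open>a\<close> be the largest integer with
  \<open>r\<^sub>n\<^sub>+\<^sub>1 - r\<^sub>n \<ge> a\<close> infinitely often. Then \<open>r\<^sub>m \<ge> a (m - s)\<close> for all \<open>m\<close>, while \<open>r\<^sub>n - a n\<close> is
  eventually nonincreasing; a nonincreasing integer sequence bounded below is eventually constant.
\<close>

subsection \<open>Rank of a matroid\<close>

lemma matroid_finite:
  assumes "matroid G I"
  shows "finite I" and "X \<in> I \<Longrightarrow> finite X"
  using assms unfolding matroid_def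
  by (meson finite_Pow_iff finite_subset, meson PowD finite_subset subsetD)

lemma matroid_subset: "matroid G I \<Longrightarrow> X \<in> I \<Longrightarrow> Y \<subseteq> X \<Longrightarrow> Y \<in> I"
  unfolding matroid_def by blast

lemma matroid_exchange:
  assumes "matroid G I" "X \<in> I" "Y \<in> I" "card X < card Y"
  obtains e where "e \<in> Y" "e \<notin> X" "insert e X \<in> I"
proof -
  have "\<forall>X Y. X \<in> I \<and> Y \<in> I \<and> card X < card Y \<longrightarrow> (\<exists>e\<in>Y - X. insert e X \<in> I)"
    using assms(1) unfolding matroid_def by (elim conjE)
  then have "\<exists>e\<in>Y - X. insert e X \<in> I" using assms(2-) by simp
  then show ?thesis using that by auto
qed

lemma card_le_mrank:
  assumes "matroid G I" "X \<in> I" "X \<subseteq> A"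
  shows "card X \<le> mrank I A"
  unfolding mrank_def using assms matroid_finite(1)[OF assms(1)] by (intro Max_ge) auto

lemma mrank_attained:
  assumes "matroid G I"
  obtains X where "X \<in> I" "X \<subseteq> A" "card X = mrank I A"
proof -
  have "mrank I A \<in> card ` {X \<in> I. X \<subseteq> A}"
    unfolding mrank_def using assms matroid_finite(1)[OF assms]
    by (intro Max_in) (auto simp: matroid_def)
  then show ?thesis using that by auto
qed

lemma mrank_mono:
  assumes "matroid G I" "A \<subseteq> B"
  shows "mrank I A \<le> mrank I B"
  by (metis assms card_le_mrank mrank_attained subset_trans)

lemma mrank_le_card:
  assumes "matroid G I" "finite A"
  shows "mrank I A \<le> card A"
  by (metis assms card_mono mrank_attained)

text \<open>Induction on the deficit \<open>mrank I A - card X\<close>: exchange against a maximum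
  independent subset of \<open>A\<close> supplies one further element.\<close>

lemma extend_to_basis:
  assumes "matroid G I" "X \<in> I" "X \<subseteq> A"
  obtains Y where "Y \<in> I" "X \<subseteq> Y" "Y \<subseteq> A" "card Y = mrank I A"
proof -
  have "\<exists>Y\<in>I. X \<subseteq> Y \<and> Y \<subseteq> A \<and> card Y = mrank I A"
    using assms(2,3)
  proof (induction "mrank I A - card X" arbitrary: X)
    case 0
    then show ?case using card_le_mrank[OF assms(1), of X A] by (intro bexI[of _ X]) auto
  next
    case (Suc k)
    obtain B where B: "B \<in> I" "B \<subseteq> A" "card B = mrank I A"
      using mrank_attained[OF assms(1)] .
    have "card X < card B" using Suc.hyps(2) B(3) by simp
    then obtain e where e: "e \<in> B" "e \<notin> X" "insert e X \<in> I"
      using matroid_exchange[OF assms(1) Suc.prems(1) B(1)] by metis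
    have "card (insert e X) = Suc (card X)"
      using e matroid_finite(2)[OF assms(1) Suc.prems(1)] by simp
    then have "k = mrank I A - card (insert e X)" using Suc.hyps(2) by simp
    then have "\<exists>Y\<in>I. insert e X \<subseteq> Y \<and> Y \<subseteq> A \<and> card Y = mrank I A"
      by (rule Suc.hyps(1)) (use e B(2) Suc.prems(2) in auto)
    then show ?case by blast
  qed
  then show ?thesis using that by blast
qed

text \<open>A basis \<open>X\<close> of the intersection extends to a basis \<open>Y\<close> of the
  union. Both \<open>Y \<inter> A\<close> and \<open>Y \<inter> B\<close> are independent, and they
  overlap in at least \<open>X\<close>.\<close>

lemma mrank_submodular:
  assumes "matroid G I"
  shows "mrank I (A \<union> B) + mrank I (A \<inter> B) \<le> mrank I A + mrank I B"
proof -
  obtain X where X: "X \<in> I" "X \<subseteq> A \<inter> B" "card X = mrank I (A \<inter> B)"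
    using mrank_attained[OF assms] .
  obtain Y where Y: "Y \<in> I" "X \<subseteq> Y" "Y \<subseteq> A \<union> B" "card Y = mrank I (A \<union> B)"
    using extend_to_basis[OF assms X(1), of "A \<union> B"] X(2) by blast
  have fin: "finite Y" using matroid_finite(2)[OF assms Y(1)] .
  have "card (Y \<inter> A) + card (Y \<inter> B) = card ((Y \<inter> A) \<union> (Y \<inter> B)) + card ((Y \<inter> A) \<inter> (Y \<inter> B))"
    using fin by (intro card_Un_Int) auto
  moreover have "(Y \<inter> A) \<union> (Y \<inter> B) = Y" using Y(3) by blast
  moreover have "card X \<le> card ((Y \<inter> A) \<inter> (Y \<inter> B))"
    using X(2) Y(2) fin by (intro card_mono) auto
  moreover have "card (Y \<inter> A) \<le> mrank I A" "card (Y \<inter> B) \<le> mrank I B"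
    using card_le_mrank[OF assms] matroid_subset[OF assms Y(1)] by auto
  ultimately show ?thesis using X(3) Y(4) by simp
qed

text \<open>The rest of a cycle spans \<open>e\<close>, hence so does any superset of that rest. For
  \<open>e \<notin> A\<close> this is submodularity for \<open>A\<close> and \<open>C\<close>, which
  meet in \<open>C - {e}\<close>.\<close>

lemma mrank_insert_is_cycle:
  assumes M: "matroid G I" and "is_cycle I C" "e \<in> C" "C - {e} \<subseteq> A"
  shows "mrank I (insert e A) = mrank I A"
proof (cases "e \<in> A")
  case False
  have "A \<union> C = insert e A" "A \<inter> C = C - {e}" using assms False by auto
  moreover have "mrank I (C - {e}) = mrank I C" using assms unfolding is_cycle_def by blast
  ultimately have "mrank I (insert e A) \<le> mrank I A"
    using mrank_submodular[OF M, of A C] by simp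
  then show ?thesis using mrank_mono[OF M, of A "insert e A"] by (simp add: antisym subset_insertI)
qed (simp add: insert_absorb)


subsection \<open>Complete graphs on vertex sets\<close>

definition complete_edges :: "'a set \<Rightarrow> 'a set set" where
  "complete_edges W = {{u, v} | u v. u \<in> W \<and> v \<in> W \<and> u \<noteq> v}"

lemma Kn_edges_eq: "Kn_edges n = complete_edges {..<n}"
  unfolding Kn_edges_def complete_edges_def by simp

lemma finite_complete_edges: "finite W \<Longrightarrow> finite (complete_edges W)"
  by (rule finite_subset[of _ "Pow W"]) (auto simp: complete_edges_def)

lemma complete_edges_mono: "W \<subseteq> W' \<Longrightarrow> complete_edges W \<subseteq> complete_edges W'"
  unfolding complete_edges_def by blast

lemma complete_edges_insert:
  "v \<notin> X \<Longrightarrow> complete_edges (insert v X) = complete_edges X \<union> (\<lambda>x. {v, x}) ` X"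
  unfolding complete_edges_def by (auto simp: insert_commute)

lemma complete_edges_insert2:
  assumes "v \<noteq> w" "v \<notin> X" "w \<notin> X"
  shows "complete_edges (insert v (insert w X)) =
    insert {v, w} (complete_edges (insert v X) \<union> complete_edges (insert w X))"
  using assms by (auto simp: complete_edges_insert)

lemma complete_edges_Int: "complete_edges W \<inter> complete_edges W' = complete_edges (W \<inter> W')"
  unfolding complete_edges_def by (auto simp: doubleton_eq_iff) blast+

lemma image_complete_edges:
  "inj_on f W \<Longrightarrow> (\<lambda>e. f ` e) ` complete_edges W = complete_edges (f ` W)"
proof (intro equalityI subsetI)
  fix e assume inj: "inj_on f W" and "e \<in> (\<lambda>e. f ` e) ` complete_edges W"
  then obtain u v where "e = {f u, f v}" "u \<in> W" "v \<in> W" "u \<noteq> v"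
    unfolding complete_edges_def by auto
  then show "e \<in> complete_edges (f ` W)"
    using inj unfolding complete_edges_def inj_on_def by blast
next
  fix e assume "e \<in> complete_edges (f ` W)"
  then obtain u v where uv: "e = {f u, f v}" "u \<in> W" "v \<in> W" "f u \<noteq> f v"
    unfolding complete_edges_def by blast
  then have "e = f ` {u, v}" "{u, v} \<in> complete_edges W" unfolding complete_edges_def by auto
  then show "e \<in> (\<lambda>e. f ` e) ` complete_edges W" by blast
qed

lemma inj_on_image_complete_edges: "inj_on f W \<Longrightarrow> inj_on (\<lambda>e. f ` e) (complete_edges W)"
  by (rule inj_on_subset[OF inj_on_image_Pow]) (auto simp: complete_edges_def)


subsection \<open>Increments of the rank in a weakly saturated matroid\<close>

text \<open>Send one edge of the graph to \<open>{v, w}\<close> and the other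
  \<open>card V - 2\<close> vertices injectively into \<open>X\<close>. No other edge of this copy
  contains both \<open>v\<close> and \<open>w\<close>, so each lies in one of the two complete
  graphs, and the cycle property spans \<open>{v, w}\<close>.\<close>

lemma weakly_sat_new_edge:
  assumes F: "simple_graph V E" "E \<noteq> {}" and ws: "weakly_sat n V E I"
    and X: "X \<subseteq> {..<n}" "card V - 2 \<le> card X"
    and vw: "v < n" "w < n" "v \<noteq> w" "v \<notin> X" "w \<notin> X"
  shows "mrank I (complete_edges (insert v (insert w X)))
       = mrank I (complete_edges (insert v X) \<union> complete_edges (insert w X))"
proof -
  obtain e where "e \<in> E" using F(2) by blast
  then obtain a b where ab: "{a, b} \<in> E" "a \<noteq> b" "a \<in> V" "b \<in> V"
    using F(1) unfolding simple_graph_def by metis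
  have finV: "finite V" and finX: "finite X"
    using F X(1) finite_subset unfolding simple_graph_def by auto
  have "card (V - {a, b}) \<le> card X" using ab finV X(2) by (simp add: card_Diff_subset)
  then obtain g where g: "inj_on g (V - {a, b})" "g ` (V - {a, b}) \<subseteq> X"
    using card_le_inj[of "V - {a, b}" X] finV finX by auto
  define h where "h = g(a := v, b := w)"
  have h: "h a = v" "h b = w" using ab by (auto simp: h_def)
  have hX: "h x \<in> X" if "x \<in> V" "x \<noteq> a" "x \<noteq> b" for x
    using that g(2) by (auto simp: h_def)
  have "inj_on h (V - {a, b})"
    using g(1) by (rule inj_on_cong[THEN iffD1, rotated]) (simp add: h_def)
  moreover have "v \<notin> h ` (V - {a, b})" "w \<notin> h ` (V - {a, b})"
    using hX vw by auto
  ultimately have "inj_on h (insert a (insert b (V - {a, b})))"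
    using h vw(3) by (auto simp: inj_on_insert)
  moreover have "insert a (insert b (V - {a, b})) = V" using ab by blast
  ultimately have inj: "inj_on h V" by simp
  have "h ` V \<subseteq> {..<n}" using hX h X(1) vw by fastforce
  then have "(\<lambda>e. h ` e) ` E \<in> copies_in_Kn n V E"
    using inj unfolding copies_in_Kn_def by blast
  then have cyc: "is_cycle I ((\<lambda>e. h ` e) ` E)" and M: "matroid (Kn_edges n) I"
    using ws unfolding weakly_sat_def by auto
  have "{v, w} \<in> (\<lambda>e. h ` e) ` E" using imageI[OF ab(1), of "\<lambda>e. h ` e"] h by simp
  moreover have "(\<lambda>e. h ` e) ` E - {{v, w}} \<subseteq> complete_edges (insert v X) \<union> complete_edges (insert w X)"
  proof
    fix e assume e: "e \<in> (\<lambda>e. h ` e) ` E - {{v, w}}"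
    then obtain d where d: "d \<in> E" "e = h ` d" by blast
    then obtain x y where "d = {x, y}" "x \<noteq> y" "x \<in> V" "y \<in> V"
      using F(1) unfolding simple_graph_def by metis
    then have xy: "e = {h x, h y}" "x \<noteq> y" "x \<in> V" "y \<in> V" using d by auto
    have ne: "h x \<noteq> h y" using inj xy unfolding inj_on_def by blast
    have range: "h z \<in> insert v (insert w X)" if "z \<in> V" for z using hX h that by (cases "z = a"; cases "z = b") auto
    have "e \<noteq> {v, w}" using e by blast
    then have "(h x \<in> insert v X \<and> h y \<in> insert v X) \<or> (h x \<in> insert w X \<and> h y \<in> insert w X)"
      using range[OF xy(3)] range[OF xy(4)] xy(1) by (auto simp: doubleton_eq_iff)
    then show "e \<in> complete_edges (insert v X) \<union> complete_edges (insert w X)"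
      unfolding complete_edges_def using xy(1) ne by blast
  qed
  ultimately show ?thesis
    using mrank_insert_is_cycle[OF M cyc] vw by (simp add: complete_edges_insert2)
qed

text \<open>Submodularity for the complete graphs on \<open>insert v X\<close> and
  \<open>insert w X\<close>: they meet in that on \<open>X\<close>, and their union misses only the
  edge \<open>{v, w}\<close>, which it spans.\<close>

lemma mrank_increment_step:
  assumes F: "simple_graph V E" "E \<noteq> {}" and ws: "weakly_sat n V E I"
    and X: "X \<subseteq> {..<n}" "card V - 2 \<le> card X"
    and vw: "v < n" "w < n" "v \<noteq> w" "v \<notin> X" "w \<notin> X"
  shows "mrank I (complete_edges (insert v (insert w X))) + mrank I (complete_edges X)
       \<le> mrank I (complete_edges (insert v X)) + mrank I (complete_edges (insert w X))"
proof -
  have M: "matroid (Kn_edges n) I" using ws unfolding weakly_sat_def by simp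
  have "insert v X \<inter> insert w X = X" using vw by auto
  then show ?thesis
    using mrank_submodular[OF M, of "complete_edges (insert v X)" "complete_edges (insert w X)"]
      weakly_sat_new_edge[OF assms] by (simp add: complete_edges_Int)
qed

text \<open>The vertices of \<open>Y - X\<close> are added to \<open>X\<close> one at a time. The
  additive form avoids truncated subtraction.\<close>

lemma mrank_increment_antimono:
  assumes F: "simple_graph V E" "E \<noteq> {}" and ws: "weakly_sat n V E I"
    and XY: "X \<subseteq> Y" "Y \<subseteq> {..<n}" "card V - 2 \<le> card X" and v: "v < n" "v \<notin> Y"
  shows "mrank I (complete_edges (insert v Y)) + mrank I (complete_edges X)
       \<le> mrank I (complete_edges (insert v X)) + mrank I (complete_edges Y)"
proof -
  have "finite Y" using XY(2) finite_subset by blast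
  then have "finite (Y - X)" by simp
  moreover have "Z \<subseteq> Y - X \<Longrightarrow> mrank I (complete_edges (insert v (X \<union> Z))) + mrank I (complete_edges X)
       \<le> mrank I (complete_edges (insert v X)) + mrank I (complete_edges (X \<union> Z))"
    if "finite Z" for Z
    using that
  proof (induction Z)
    case (insert w Z)
    have "card V - 2 \<le> card (X \<union> Z)"
      using XY(3) card_mono[of "X \<union> Z" X] insert.hyps(1) XY(1) \<open>finite Y\<close> finite_subset[of X Y] by simp
    then have "mrank I (complete_edges (insert v (insert w (X \<union> Z)))) + mrank I (complete_edges (X \<union> Z))
       \<le> mrank I (complete_edges (insert v (X \<union> Z))) + mrank I (complete_edges (insert w (X \<union> Z)))"
      using insert.prems insert.hyps XY v by (intro mrank_increment_step[OF F ws]) auto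
    then show ?case using insert by simp
  qed simp
  ultimately have "mrank I (complete_edges (insert v (X \<union> (Y - X)))) + mrank I (complete_edges X)
       \<le> mrank I (complete_edges (insert v X)) + mrank I (complete_edges (X \<union> (Y - X)))"
    by blast
  moreover have "X \<union> (Y - X) = Y" using XY(1) by blast
  ultimately show ?thesis by simp
qed


subsection \<open>Pulling back along an injection of vertices\<close>

definition pullback :: "('a \<Rightarrow> 'b) \<Rightarrow> 'a set \<Rightarrow> 'b set set set \<Rightarrow> 'a set set set" where
  "pullback f W I = {X. X \<subseteq> complete_edges W \<and> (\<lambda>e. f ` e) ` X \<in> I}"

lemma matroid_pullback:
  assumes M: "matroid G I" and inj: "inj_on f W" and fin: "finite W"
  shows "matroid (complete_edges W) (pullback f W I)"
proof -
  let ?h = "\<lambda>e. f ` e"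
  have injE: "inj_on ?h (complete_edges W)" by (rule inj_on_image_complete_edges[OF inj])
  have card: "card (?h ` X) = card X" if "X \<subseteq> complete_edges W" for X
    using card_image inj_on_subset[OF injE that] by blast
  show ?thesis
    unfolding matroid_def
  proof (intro conjI allI impI)
    show "finite (complete_edges W)" by (rule finite_complete_edges[OF fin])
    show "pullback f W I \<subseteq> Pow (complete_edges W)" unfolding pullback_def by blast
    show "{} \<in> pullback f W I" using M unfolding pullback_def matroid_def by simp
  next
    fix X Y assume "X \<in> pullback f W I \<and> Y \<subseteq> X"
    then show "Y \<in> pullback f W I"
      using matroid_subset[OF M, of "?h ` X" "?h ` Y"] unfolding pullback_def by auto
  next
    fix X Y assume XY: "X \<in> pullback f W I \<and> Y \<in> pullback f W I \<and> card X < card Y"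
    then have "card (?h ` X) < card (?h ` Y)" using card unfolding pullback_def by simp
    moreover have "?h ` X \<in> I" "?h ` Y \<in> I" using XY unfolding pullback_def by auto
    ultimately obtain e where e: "e \<in> ?h ` Y" "e \<notin> ?h ` X" "insert e (?h ` X) \<in> I"
      using matroid_exchange[OF M, of "?h ` X" "?h ` Y"] by metis
    then obtain d where "d \<in> Y" "e = ?h d" by blast
    then show "\<exists>e\<in>Y - X. insert e X \<in> pullback f W I"
      using e XY unfolding pullback_def by (intro bexI[of _ d]) auto
  qed
qed

lemma mrank_pullback:
  assumes inj: "inj_on f W" and A: "A \<subseteq> complete_edges W"
  shows "mrank (pullback f W I) A = mrank I ((\<lambda>e. f ` e) ` A)"
proof -
  let ?h = "\<lambda>e. f ` e"
  have injA: "inj_on ?h A" using inj_on_subset[OF inj_on_image_complete_edges[OF inj] A] .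
  have "card ` {X \<in> I. X \<subseteq> ?h ` A} = card ` {X \<in> pullback f W I. X \<subseteq> A}"
  proof safe
    fix X assume "X \<in> I" "X \<subseteq> ?h ` A"
    then obtain Y where Y: "Y \<subseteq> A" "X = ?h ` Y" by (meson subset_imageE)
    then have "card X = card Y" using card_image inj_on_subset[OF injA] by blast
    then show "card X \<in> card ` {X \<in> pullback f W I. X \<subseteq> A}"
      using Y A \<open>X \<in> I\<close> unfolding pullback_def by auto
  next
    fix X assume X: "X \<in> pullback f W I" "X \<subseteq> A"
    then have "card (?h ` X) = card X" using card_image inj_on_subset[OF injA] by blast
    then show "card X \<in> card ` {X \<in> I. X \<subseteq> ?h ` A}"
      using X unfolding pullback_def by (intro image_eqI[of _ _ "?h ` X"]) auto
  qed
  then show ?thesis unfolding mrank_def by simp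
qed

text \<open>Composing a copy in the smaller complete graph with \<open>f\<close> gives a copy in the
  larger one, and \<open>f\<close> preserves ranks.\<close>

lemma weakly_sat_pullback:
  assumes F: "simple_graph V E" and ws: "weakly_sat n V E I"
    and f: "inj_on f {..<m}" "f ` {..<m} \<subseteq> {..<n}"
  shows "weakly_sat m V E (pullback f {..<m} I)"
  unfolding weakly_sat_def
proof (intro conjI ballI)
  have M: "matroid (Kn_edges n) I" using ws unfolding weakly_sat_def by simp
  show "matroid (Kn_edges m) (pullback f {..<m} I)"
    unfolding Kn_edges_eq by (rule matroid_pullback[OF M f(1)]) simp
  let ?h = "\<lambda>e. f ` e"
  fix C assume "C \<in> copies_in_Kn m V E"
  then obtain g where g: "C = (\<lambda>e. g ` e) ` E" "inj_on g V" "g ` V \<subseteq> {..<m}"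
    unfolding copies_in_Kn_def by blast
  have "E \<subseteq> complete_edges V" using F unfolding simple_graph_def complete_edges_def by blast
  then have C: "C \<subseteq> complete_edges {..<m}"
    using image_mono[of E "complete_edges V" "\<lambda>e. g ` e"] image_complete_edges[OF g(2)]
      complete_edges_mono[OF g(3)] by (simp add: g(1))
  have "?h ` C = (\<lambda>e. (f \<circ> g) ` e) ` E" by (simp add: g(1) image_image image_comp)
  moreover have "inj_on (f \<circ> g) V" using comp_inj_on[OF g(2) inj_on_subset[OF f(1) g(3)]] .
  moreover have "(f \<circ> g) ` V \<subseteq> {..<n}" using g f by auto
  ultimately have "?h ` C \<in> copies_in_Kn n V E" unfolding copies_in_Kn_def by blast
  then have cyc: "is_cycle I (?h ` C)" using ws unfolding weakly_sat_def by blast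
  show "is_cycle (pullback f {..<m} I) C"
    unfolding is_cycle_def
  proof
    fix e assume e: "e \<in> C"
    have "?h ` (C - {e}) = ?h ` C - {?h e}"
      using inj_on_image_set_diff[OF inj_on_image_complete_edges[OF f(1)], of C "{e}"] C e by auto
    moreover have "mrank I (?h ` C - {?h e}) = mrank I (?h ` C)"
      using cyc e unfolding is_cycle_def by blast
    moreover have "C - {e} \<subseteq> complete_edges {..<m}" using C by blast
    ultimately show "mrank (pullback f {..<m} I) (C - {e}) = mrank (pullback f {..<m} I) C"
      using C by (simp add: mrank_pullback[OF f(1)])
  qed
qed


subsection \<open>The weak saturation rank\<close>

lemma finite_weakly_sat_ranks: "finite {mrank I (Kn_edges n) | I. weakly_sat n V E I}"
proof (rule finite_subset)
  have "mrank I (Kn_edges n) \<le> card (Kn_edges n)" if "weakly_sat n V E I" for I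
  proof (rule mrank_le_card)
    show "matroid (Kn_edges n) I" using that unfolding weakly_sat_def by simp
    show "finite (Kn_edges n)" by (simp add: Kn_edges_eq finite_complete_edges)
  qed
  then show "{mrank I (Kn_edges n) | I. weakly_sat n V E I} \<subseteq> {..card (Kn_edges n)}" by blast
qed simp

text \<open>The rank-zero matroid makes the set of ranks nonempty, so that the maximum in
  \<open>rk_sat\<close> is attained.\<close>

lemma weakly_sat_trivial: "weakly_sat n V E {{}}"
proof -
  have "{X \<in> {{}}. X \<subseteq> A} = {{}}" for A :: "nat set set" by auto
  then have "mrank {{}} A = 0" for A :: "nat set set" unfolding mrank_def by simp
  moreover have "matroid (Kn_edges n) {{}}"
    using finite_complete_edges[of "{..<n}"] by (auto simp: matroid_def Kn_edges_eq)
  ultimately show ?thesis unfolding weakly_sat_def is_cycle_def by simp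
qed

lemma mrank_le_rk_sat: "weakly_sat n V E I \<Longrightarrow> mrank I (Kn_edges n) \<le> rk_sat n V E"
  unfolding rk_sat_def by (rule Max_ge[OF finite_weakly_sat_ranks]) blast

lemma rk_sat_attained:
  obtains I where "weakly_sat n V E I" "mrank I (Kn_edges n) = rk_sat n V E"
proof -
  have "rk_sat n V E \<in> {mrank I (Kn_edges n) | I. weakly_sat n V E I}"
    unfolding rk_sat_def using weakly_sat_trivial by (intro Max_in[OF finite_weakly_sat_ranks]) blast
  then show ?thesis using that by auto
qed

lemma mrank_complete_edges_le_rk_sat:
  assumes F: "simple_graph V E" and ws: "weakly_sat n V E I" and W: "W \<subseteq> {..<n}"
  shows "mrank I (complete_edges W) \<le> rk_sat (card W) V E"
proof -
  have "finite W" using W finite_subset by blast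
  then obtain f where "bij_betw f {..<card W} W"
    using ex_bij_betw_nat_finite lessThan_atLeast0 by metis
  then have f: "inj_on f {..<card W}" "f ` {..<card W} = W" unfolding bij_betw_def by auto
  then show ?thesis
    using mrank_le_rk_sat[OF weakly_sat_pullback[OF F ws f(1)]] W
      mrank_pullback[OF f(1) order_refl, of I] image_complete_edges[OF f(1)]
    by (simp add: Kn_edges_eq)
qed

text \<open>In an optimal matroid, deleting vertex \<open>k\<close> leaves rank at most
  \<open>rk_sat n V E\<close>, which bounds the last increment at \<open>k\<close> from below;
  smaller sets \<open>X\<close> have increments at least as large. A single \<open>I\<close> serves
  all \<open>k\<close> and \<open>X\<close>, so the bounds can later be summed.\<close>

lemma rk_sat_increment_le:
  assumes F: "simple_graph V E" "E \<noteq> {}" and n: "card V - 2 \<le> n"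
  shows "\<exists>I. weakly_sat (Suc n) V E I \<and> (\<forall>k X. k \<le> n \<and> k \<notin> X \<and> X \<subseteq> {..n} \<and> card V - 2 \<le> card X \<longrightarrow>
    rk_sat (Suc n) V E + mrank I (complete_edges X) \<le> rk_sat n V E + mrank I (complete_edges (insert k X)))"
proof -
  obtain I where I: "weakly_sat (Suc n) V E I" "mrank I (Kn_edges (Suc n)) = rk_sat (Suc n) V E"
    using rk_sat_attained .
  have "rk_sat (Suc n) V E + mrank I (complete_edges X) \<le> rk_sat n V E + mrank I (complete_edges (insert k X))"
    if X: "k \<le> n" "k \<notin> X" "X \<subseteq> {..n}" "card V - 2 \<le> card X" for k X
  proof -
    let ?Y = "{..<Suc n} - {k}"
    have "mrank I (complete_edges (insert k ?Y)) + mrank I (complete_edges X)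
       \<le> mrank I (complete_edges (insert k X)) + mrank I (complete_edges ?Y)"
      using X by (intro mrank_increment_antimono[OF F I(1)]) auto
    moreover have "insert k ?Y = {..<Suc n}" "card ?Y = n" using X(1) by auto
    ultimately show ?thesis
      using I(2) mrank_complete_edges_le_rk_sat[OF F(1) I(1), of ?Y] by (simp add: Kn_edges_eq)
  qed
  then show ?thesis using I(1) by blast
qed

text \<open>The increment bound is applied to the smallest admissible set \<open>{..<?s}\<close>,
  where a new vertex brings only \<open>?s\<close> edges.\<close>

lemma rk_sat_Suc_le:
  assumes F: "simple_graph V E" "E \<noteq> {}" and n: "card V - 2 \<le> n"
  shows "rk_sat (Suc n) V E \<le> rk_sat n V E + (card V - 2)"
proof -
  let ?s = "card V - 2"
  obtain I where I: "weakly_sat (Suc n) V E I"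
    "\<forall>k X. k \<le> n \<and> k \<notin> X \<and> X \<subseteq> {..n} \<and> ?s \<le> card X \<longrightarrow>
    rk_sat (Suc n) V E + mrank I (complete_edges X) \<le> rk_sat n V E + mrank I (complete_edges (insert k X))"
    using rk_sat_increment_le[OF assms] by blast
  have M: "matroid (Kn_edges (Suc n)) I" using I(1) unfolding weakly_sat_def by simp
  let ?S = "(\<lambda>x. {?s, x}) ` {..<?s}"
  have "rk_sat (Suc n) V E + mrank I (complete_edges {..<?s}) \<le> rk_sat n V E + mrank I (complete_edges (insert ?s {..<?s}))"
    using n by (intro I(2)[rule_format]) auto
  also have "complete_edges (insert ?s {..<?s}) = complete_edges {..<?s} \<union> ?S"
    by (rule complete_edges_insert) simp
  also have "mrank I (complete_edges {..<?s} \<union> ?S) \<le> mrank I (complete_edges {..<?s}) + mrank I ?S"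
    using mrank_submodular[OF M, of "complete_edges {..<?s}" ?S] by linarith
  also have "mrank I ?S \<le> ?s"
    using mrank_le_card[OF M, of ?S] card_image_le[of "{..<?s}" "\<lambda>x. {?s, x}"] by simp
  finally show ?thesis by simp
qed

text \<open>One increment of at least \<open>d\<close> at some \<open>n \<ge> m\<close> forces each
  vertex from \<open>card V - 2\<close> to \<open>m - 1\<close> to add at least \<open>d\<close>
  within the same matroid; these contributions are summed.\<close>

lemma rk_sat_ge_of_increment:
  assumes F: "simple_graph V E" "E \<noteq> {}" and n: "card V - 2 \<le> n" "m \<le> n"
    and d: "rk_sat n V E + d \<le> rk_sat (Suc n) V E"
  shows "d * m \<le> rk_sat m V E + d * (card V - 2)"
proof -
  let ?s = "card V - 2"
  obtain I where I: "weakly_sat (Suc n) V E I"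
    "\<forall>k X. k \<le> n \<and> k \<notin> X \<and> X \<subseteq> {..n} \<and> ?s \<le> card X \<longrightarrow>
    rk_sat (Suc n) V E + mrank I (complete_edges X) \<le> rk_sat n V E + mrank I (complete_edges (insert k X))"
    using rk_sat_increment_le[OF F n(1)] by blast
  have step: "mrank I (complete_edges {..<k}) + d \<le> mrank I (complete_edges {..<Suc k})"
    if "?s \<le> k" "k \<le> n" for k
  proof -
    have "rk_sat (Suc n) V E + mrank I (complete_edges {..<k})
        \<le> rk_sat n V E + mrank I (complete_edges (insert k {..<k}))"
      using that by (intro I(2)[rule_format]) auto
    then show ?thesis using d by (simp add: lessThan_Suc)
  qed
  have "k \<le> n \<Longrightarrow> d * k \<le> mrank I (complete_edges {..<k}) + d * ?s" for k
  proof (induction k)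
    case (Suc k)
    show ?case
    proof (cases "?s \<le> k")
      case True
      then show ?thesis using Suc step[of k] by simp
    next
      case False
      \<comment> \<open>Below \<open>?s\<close> no increment bound is available, but the term
        \<open>d * ?s\<close> already covers the claim.\<close>
      then have "d * Suc k \<le> d * ?s" by (intro mult_le_mono2) simp
      then show ?thesis by linarith
    qed
  qed simp
  moreover have "mrank I (complete_edges {..<m}) \<le> rk_sat m V E"
    using mrank_complete_edges_le_rk_sat[OF F(1) I(1), of "{..<m}"] n by simp
  ultimately show ?thesis using n(2) by (meson add_le_mono1 order_trans)
qed

section \<open>Eventual linearity of the rank sequence\<close>

lemma eventually_const_of_antimono:
  fixes h :: "nat \<Rightarrow> nat"
  assumes "\<And>n. N \<le> n \<Longrightarrow> h (Suc n) \<le> h n"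
  obtains N' c where "\<And>n. N' \<le> n \<Longrightarrow> h n = c"
proof -
  \<comment> \<open>Once the least value is reached, the sequence can neither rise nor fall.\<close>
  obtain k where k: "N \<le> k" "\<And>n. N \<le> n \<Longrightarrow> h k \<le> h n"
    using ex_has_least_nat[of "\<lambda>n. N \<le> n" N h] by blast
  have "h n = h k" if "k \<le> n" for n
    using that
  proof (induction n rule: dec_induct)
    case (step n)
    then show ?case using assms[of n] k(1) k(2)[of "Suc n"] by simp
  qed simp
  then show ?thesis using that by blast
qed

text \<open>Take the largest \<open>a\<close> for which increments of at least \<open>a\<close>
  occur infinitely often; by maximality all late increments are at most \<open>a\<close>.\<close>

lemma rk_sat_frequent_increment:
  assumes F: "simple_graph V E" "E \<noteq> {}"
  obtains a where "\<And>N. \<exists>n\<ge>N. rk_sat n V E + a \<le> rk_sat (Suc n) V E"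
    and "\<exists>N. \<forall>n\<ge>N. rk_sat (Suc n) V E \<le> rk_sat n V E + a"
proof -
  let ?r = "\<lambda>n. rk_sat n V E"
  define P where "P d \<longleftrightarrow> (\<forall>N. \<exists>n\<ge>N. ?r n + d \<le> ?r (Suc n))" for d
  \<comment> \<open>Otherwise the ranks, being natural numbers, would eventually decrease strictly
    forever.\<close>
  have "P 0"
  proof (rule ccontr)
    assume "\<not> P 0"
    then obtain N where N: "\<And>n. N \<le> n \<Longrightarrow> ?r (Suc n) < ?r n"
      unfolding P_def by (metis add_0_right not_le)
    then obtain N' c where c: "\<And>n. N' \<le> n \<Longrightarrow> ?r n = c"
      using eventually_const_of_antimono[of N ?r] less_imp_le by metis
    show False
      using N[of "max N N'"] c[of "max N N'"] c[of "Suc (max N N')"] by (simp add: le_SucI)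
  qed
  moreover have "d \<le> card V - 2" if Pd: "P d" for d
  proof -
    obtain n where "card V - 2 \<le> n" "?r n + d \<le> ?r (Suc n)" using Pd unfolding P_def by blast
    then show ?thesis using rk_sat_Suc_le[OF F, of n] by simp
  qed
  ultimately obtain a where a: "P a" "\<And>d. P d \<Longrightarrow> d \<le> a"
    using Greatest_le_nat[of P _ "card V - 2"] GreatestI_nat[of P 0 "card V - 2"] by blast
  then have "\<not> P (Suc a)" using a(2) Suc_n_not_le_n by blast
  then have "\<exists>N. \<forall>n\<ge>N. ?r (Suc n) \<le> ?r n + a"
    unfolding P_def by (metis add_Suc_right less_Suc_eq_le not_le)
  then show ?thesis using a(1) that unfolding P_def by blast
qed

text \<open>Nonemptiness of \<open>E\<close> excludes the edgeless graph: there saturation is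
  vacuous, and the free matroid has quadratic rank.\<close>

theorem theorem1:
  fixes V :: "'a set" and E :: "'a set set"
  assumes "simple_graph V E" and "E \<noteq> {}"
  shows "\<exists>(N::nat) (a::int) (C::int). \<forall>n\<ge>N. int (rk_sat n V E) = a * int n + C"
proof -
  let ?r = "\<lambda>n. rk_sat n V E" and ?s = "card V - 2"
  obtain a N where a: "\<And>N. \<exists>n\<ge>N. ?r n + a \<le> ?r (Suc n)"
    and N: "\<And>n. N \<le> n \<Longrightarrow> ?r (Suc n) \<le> ?r n + a"
    using rk_sat_frequent_increment[OF assms] by metis
  have lower: "a * m \<le> ?r m + a * ?s" for m
  proof -
    \<comment> \<open>A frequent increment beyond both \<open>m\<close> and \<open>?s\<close>
      transfers its bound down to \<open>m\<close>.\<close>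
    obtain n where "max m ?s \<le> n" "?r n + a \<le> ?r (Suc n)" using a by blast
    then show ?thesis using rk_sat_ge_of_increment[OF assms, of n m a] by simp
  qed
  \<comment> \<open>The shift by \<open>a * ?s\<close> keeps this subtraction from truncating, by
    \<open>lower\<close>, so the excess over the line is recovered exactly.\<close>
  define h where "h n = ?r n + a * ?s - a * n" for n
  have "h (Suc n) \<le> h n" if "N \<le> n" for n
    using N[OF that] by (simp add: h_def)
  then obtain N' c where c: "\<And>n. N' \<le> n \<Longrightarrow> h n = c"
    using eventually_const_of_antimono[of N h] by metis
  have "int (?r n) = int a * int n + (int c - int (a * ?s))" if "N' \<le> n" for n
  proof -
    have "?r n + a * ?s = c + a * n" using c[OF that] lower[of n] by (simp add: h_def)
    then show ?thesis by (simp flip: of_nat_mult of_nat_add add: algebra_simps)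
  qed
  then show ?thesis by blast
qed

end
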